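(* Consider the following fourteen identities in the language $\langle \to \rangle$: (A1) $x \to (y \to z) \approx (x \to y) \to z$; (A2) $x \to (y \to z) \approx x \to (z \to y)$; (A3) $x \to (y \to z) \approx (x \to z) \to y$; (A4) $x \to (y \to z) \approx y \to (x \to z)$; (A5) $x \to (y \to z) \approx (y \to x) \to z$; (A6) $x \to (y \to z) \approx y \to (z \to x)$; (A7) $x \to (y \to z) \approx (y \to z) \to x$; (A8) $x \to (y \to z) \approx (z \to x) \to y$; (A9) $x \to (y \to z) \approx z \to (y \to x)$; (A10) $x \to (y \to z) \approx (z \to y) \to x$; (A11) $(x \to y) \to z \approx (x \to z) \to y$; (A12) $(x \to y) \to z \approx (y \to x) \to z$; (A13) $(x \to y) \to z \approx (y \to z) \to x$; (A14) $(x \to y) \to z \approx (z \to y) \to x$. For $1 \le i \le 14$ let $\mathcal A_i$ be the subvariety of $\mathcal I$ defined (relative to $\mathcal I$) by (Ai). Then: (a) Each subvariety of $\mathcal I$ of associative type equals one of $\mathcal A_1, \mathcal A_2, \mathcal A_3, \mathcal A_4, \mathcal A_6, \mathcal A_9, \mathcal A_{11}, \mathcal A_{14}$, and these $8$ varieties are pairwise distinct. (b) They satisfy the following relationships (all inclusions strict): 1. $\mathcal{SL} \subset \mathcal A_3 \subset \mathcal A_4$; 2. $\mathcal{BA} \subset \mathcal A_4 \subset \mathcal I$; 3. $\mathcal A_3 \subset \mathcal A_1 \subset \mathcal I$; 4. $\mathcal A_3 \subset \mathcal A_2 \subset \mathcal A_{11}$, $\mathcal A_3 \subset \mathcal A_6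 \subset \mathcal A_{11}$ and $\mathcal A_3 \subset \mathcal A_9 \subset \mathcal A_{11}$; 5. $\mathcal A_{11} \subset \mathcal A_{14} \subset \mathcal I$.
   Context: An implication zroupoid ($\mathcal I$-zroupoid) is an algebra $\mathbf A = \langle A, \to, 0\rangle$ with $\to$ binary and $0$ a constant satisfying $(x \to y) \to z \approx [(z' \to x) \to (y \to z)']'$ and $0'' \approx 0$, where $x' := x \to 0$ (the prime binds more tightly than $\to$). $\mathcal I$ is the variety of all $\mathcal I$-zroupoids. An identity $p \approx q$ in the groupoid language $\langle \to \rangle$ is of associative type (of length 3) if each of $p$ and $q$ contains exactly the three distinct variables $x,y,z$, each occurring once, grouped either as $\star \to (\star \to \star)$ or as $(\star \to \star) \to \star$. A subvariety of $\mathcal I$ is of associative type if it is defined, relative to $\mathcal I$, by a single identity of associative type. $\mathcal{SL}$ is the subvariety of $\mathcal I$ defined by $x' \approx x$ and $x \to y \approx y \to x$ (semilattices with least element $0$). $\mathcal{DM}$ is the subvariety of $\mathcal I$ defined by $(x \to y) \to x \approx x$, and $\mathcal{BA}$ (Boolean algebras) is the subvariety of $\mathcal{DM}$ defined by $x \to x \approx 0'$.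
   Formalization: Identities p ≈ q of associative type are required to have p and q different: a tautology p ≈ p would define the whole variety I, which by (b) is none of the eight varieties, so (a) would fail for it. *)

theory Defs
  imports Main
begin

datatype trm = Var nat | Zero | Imp trm trm (infix "\<rightarrow>" 65)

abbreviation Prime :: "trm \<Rightarrow> trm" ("_\<acute>" [1000] 1000)
  where "t\<acute> \<equiv> t \<rightarrow> Zero"

datatype identity = Identity trm trm (infix "\<approx>" 50)

text \<open>
  An algebra has an explicit carrier inside an ambient type. Values of \<open>imp\<close> outside
  the carrier are arbitrary and irrelevant; a carrier is nonempty because it contains \<open>zero\<close>.
  When \<open>'a\<close> is infinite, every variety has members in \<open>'a zroupoid\<close> isomorphic to each of
  its countable algebras, so distinct varieties yield distinct subsets of \<open>'a zroupoid\<close>.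
\<close>

record 'a zroupoid =
  carrier :: "'a set"
  imp :: "'a \<Rightarrow> 'a \<Rightarrow> 'a"
  zero :: 'a

definition algebra :: "'a zroupoid \<Rightarrow> bool" where
  "algebra A \<longleftrightarrow> zero A \<in> carrier A \<and>
     (\<forall>x\<in>carrier A. \<forall>y\<in>carrier A. imp A x y \<in> carrier A)"

primrec eval :: "'a zroupoid \<Rightarrow> (nat \<Rightarrow> 'a) \<Rightarrow> trm \<Rightarrow> 'a" where
  "eval A v (Var n) = v n"
| "eval A v Zero = zero A"
| "eval A v (s \<rightarrow> t) = imp A (eval A v s) (eval A v t)"

primrec satisfies :: "'a zroupoid \<Rightarrow> identity \<Rightarrow> bool" (infix "\<Turnstile>" 50) where
  "A \<Turnstile> (p \<approx> q) \<longleftrightarrow> (\<forall>v. range v \<subseteq> carrier A \<longrightarrow> eval A v p = eval A v q)"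

definition subvariety :: "'a zroupoid set \<Rightarrow> identity set \<Rightarrow> 'a zroupoid set" where
  "subvariety V E = {A \<in> V. \<forall>e\<in>E. A \<Turnstile> e}"

abbreviation X :: trm where "X \<equiv> Var 0"
abbreviation Y :: trm where "Y \<equiv> Var 1"
abbreviation Z :: trm where "Z \<equiv> Var 2"

definition I_variety :: "'a zroupoid set" where
  "I_variety = subvariety {A. algebra A}
     {(X \<rightarrow> Y) \<rightarrow> Z \<approx> ((Z\<acute> \<rightarrow> X) \<rightarrow> (Y \<rightarrow> Z)\<acute>)\<acute>,
      Zero\<acute>\<acute> \<approx> Zero}"

definition SL_variety :: "'a zroupoid set" where
  "SL_variety = subvariety I_variety {X\<acute> \<approx> X, X \<rightarrow> Y \<approx> Y \<rightarrow> X}"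

definition DM_variety :: "'a zroupoid set" where
  "DM_variety = subvariety I_variety {(X \<rightarrow> Y) \<rightarrow> X \<approx> X}"

definition BA_variety :: "'a zroupoid set" where
  "BA_variety = subvariety DM_variety {X \<rightarrow> X \<approx> Zero\<acute>}"

text \<open>
  For distinct \<open>x\<close>, \<open>y\<close>, \<open>z\<close>, the equation \<open>{a, b, c} = {x, y, z}\<close> says that
  \<open>a\<close>, \<open>b\<close>, \<open>c\<close> is a permutation of \<open>x\<close>, \<open>y\<close>, \<open>z\<close>.
\<close>

definition assoc_type_trm :: "nat \<Rightarrow> nat \<Rightarrow> nat \<Rightarrow> trm \<Rightarrow> bool" where
  "assoc_type_trm x y z t \<longleftrightarrow>
     (\<exists>a b c. {a, b, c} = {x, y, z} \<and>
        (t = Var a \<rightarrow> (Var b \<rightarrow> Var c) \<or> t = (Var a \<rightarrow> Var b) \<rightarrow> Var c))"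

text \<open>
  The condition \<open>p \<noteq> q\<close> excludes the tautologies \<open>p \<approx> p\<close>, which would define the whole
  variety of implication zroupoids.
\<close>

definition assoc_type_identity :: "identity \<Rightarrow> bool" where
  "assoc_type_identity e \<longleftrightarrow>
     (\<exists>p q x y z. e = (p \<approx> q) \<and> p \<noteq> q \<and> distinct [x, y, z] \<and>
        assoc_type_trm x y z p \<and> assoc_type_trm x y z q)"

definition assoc_type_subvariety :: "'a zroupoid set \<Rightarrow> bool" where
  "assoc_type_subvariety V \<longleftrightarrow>
     (\<exists>e. assoc_type_identity e \<and> V = subvariety I_variety {e})"

definition assoc_identities :: "identity list" where
  "assoc_identities =
    [X \<rightarrow> (Y \<rightarrow> Z) \<approx> (X \<rightarrow> Y) \<rightarrow> Z,
     X \<rightarrow> (Y \<rightarrow> Z) \<approx> X \<rightarrow> (Z \<rightarrow> Y),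
     X \<rightarrow> (Y \<rightarrow> Z) \<approx> (X \<rightarrow> Z) \<rightarrow> Y,
     X \<rightarrow> (Y \<rightarrow> Z) \<approx> Y \<rightarrow> (X \<rightarrow> Z),
     X \<rightarrow> (Y \<rightarrow> Z) \<approx> (Y \<rightarrow> X) \<rightarrow> Z,
     X \<rightarrow> (Y \<rightarrow> Z) \<approx> Y \<rightarrow> (Z \<rightarrow> X),
     X \<rightarrow> (Y \<rightarrow> Z) \<approx> (Y \<rightarrow> Z) \<rightarrow> X,
     X \<rightarrow> (Y \<rightarrow> Z) \<approx> (Z \<rightarrow> X) \<rightarrow> Y,
     X \<rightarrow> (Y \<rightarrow> Z) \<approx> Z \<rightarrow> (Y \<rightarrow> X),
     X \<rightarrow> (Y \<rightarrow> Z) \<approx> (Z \<rightarrow> Y) \<rightarrow> X,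
     (X \<rightarrow> Y) \<rightarrow> Z \<approx> (X \<rightarrow> Z) \<rightarrow> Y,
     (X \<rightarrow> Y) \<rightarrow> Z \<approx> (Y \<rightarrow> X) \<rightarrow> Z,
     (X \<rightarrow> Y) \<rightarrow> Z \<approx> (Y \<rightarrow> Z) \<rightarrow> X,
     (X \<rightarrow> Y) \<rightarrow> Z \<approx> (Z \<rightarrow> Y) \<rightarrow> X]"

text \<open>List positions start at 0, the identities are numbered 1 to 14.\<close>

definition \<A> :: "nat \<Rightarrow> 'a zroupoid set" where
  "\<A> i = subvariety I_variety {assoc_identities ! (i - 1)}"

end

theory Submission
  imports Defs
begin

text \<open>
  In every implication zroupoid the elements \<open>x''\<close> form a subalgebra with \<open>x'' = x\<close>, and
  \<open>(x \<rightarrow> y) \<rightarrow> z = (x'' \<rightarrow> y'') \<rightarrow> z''\<close>. In an algebra with \<open>x'' = x\<close> one has \<open>0' \<rightarrow> x = x\<close>, so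
  substituting \<open>0\<close> and \<open>0'\<close> into any of the fourteen identities except (A1), (A4), (A14) makes \<open>\<rightarrow>\<close>
  commutative; a commutative such algebra is a semilattice. Hence these eleven identities make
  \<open>(x \<rightarrow> y) \<rightarrow> z\<close> invariant under all permutations of \<open>x\<close>, \<open>y\<close>, \<open>z\<close> in every implication zroupoid.
  This invariance is equivalent to each of (A11), (A12), (A13), and together with (A1) it is
  equivalent to each of (A3), (A5), (A7), (A8), (A10) and implies all fourteen identities.
  The separations come from finite algebras, copied along an injection from \<open>nat\<close>.
\<close>

section \<open>Satisfaction of identities in three variables\<close>

primrec vars :: "trm \<Rightarrow> nat set" where
  "vars (Var n) = {n}"
| "vars Zero = {}"
| "vars (s \<rightarrow> t) = vars s \<union> vars t"

lemma eval_cong: "(\<And>i. i \<in> vars t \<Longrightarrow> v i = w i) \<Longrightarrow> eval A v t = eval A w t"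
  by (induction t) auto

text \<open>Only the values at \<open>x\<close>, \<open>y\<close>, \<open>z\<close> matter. The
  valuation on the right sends every variable other than \<open>x\<close> and \<open>y\<close> to
  \<open>c\<close>, so its range stays in the carrier.\<close>

lemma satisfies_iff:
  assumes "distinct [x, y, z]" "vars p \<union> vars q \<subseteq> {x, y, z}"
  shows "A \<Turnstile> (p \<approx> q) \<longleftrightarrow>
    (\<forall>a\<in>carrier A. \<forall>b\<in>carrier A. \<forall>c\<in>carrier A.
      eval A ((\<lambda>_. c)(x := a, y := b)) p = eval A ((\<lambda>_. c)(x := a, y := b)) q)"
proof
  assume rhs: "\<forall>a\<in>carrier A. \<forall>b\<in>carrier A. \<forall>c\<in>carrier A.
      eval A ((\<lambda>_. c)(x := a, y := b)) p = eval A ((\<lambda>_. c)(x := a, y := b)) q"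
  have "eval A v p = eval A v q" if v: "range v \<subseteq> carrier A" for v
  proof -
    define w where "w = (\<lambda>_. v z)(x := v x, y := v y)"
    have "eval A v p = eval A w p" "eval A v q = eval A w q"
      using assms by (auto simp: w_def intro!: eval_cong)
    moreover have "eval A w p = eval A w q"
      unfolding w_def using v by (intro rhs[rule_format]) auto
    ultimately show ?thesis by simp
  qed
  then show "A \<Turnstile> (p \<approx> q)" by simp
qed (force simp: image_subset_iff)

lemmas satisfies_XYZ = satisfies_iff[of 0 "Suc 0" 2]

section \<open>Double negation in implication zroupoids\<close>

locale I_zroupoid =
  fixes C :: "'a set" and arrow :: "'a \<Rightarrow> 'a \<Rightarrow> 'a" (infix "\<leadsto>" 70) and null :: 'a ("\<zero>")
  assumes zero_closed [simp]: "\<zero> \<in> C"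
    and imp_closed [simp]: "x \<in> C \<Longrightarrow> y \<in> C \<Longrightarrow> x \<leadsto> y \<in> C"
    and imp_imp: "x \<in> C \<Longrightarrow> y \<in> C \<Longrightarrow> z \<in> C \<Longrightarrow>
      (x \<leadsto> y) \<leadsto> z = (((z \<leadsto> \<zero>) \<leadsto> x) \<leadsto> ((y \<leadsto> z) \<leadsto> \<zero>)) \<leadsto> \<zero>"
    and zero_zero_zero: "(\<zero> \<leadsto> \<zero>) \<leadsto> \<zero> = \<zero>"
begin

abbreviation neg ("\<sim> _" [90] 90) where "\<sim> x \<equiv> x \<leadsto> \<zero>"

abbreviation alg where "alg \<equiv> \<lparr>carrier = C, imp = (\<leadsto>), zero = \<zero>\<rparr>"

text \<open>This is \<open>imp_imp\<close> at z = 0. The lemmas below develop it until, under a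
  negation, \<open>\<sim>\<zero> \<leadsto>\<close> and double negations can be inserted or dropped
  at either factor.\<close>

lemma neg_imp: "\<lbrakk>x \<in> C; y \<in> C\<rbrakk> \<Longrightarrow> \<sim>((\<sim>\<zero> \<leadsto> x) \<leadsto> \<sim>\<sim>y) = \<sim>(x \<leadsto> y)"
  using imp_imp[of x y \<zero>] by simp

lemma neg_neg_one_imp: "x \<in> C \<Longrightarrow> \<sim>\<sim>(\<sim>\<zero> \<leadsto> x) = \<sim>\<sim>x"
  using neg_imp[of x \<zero>] by (simp add: zero_zero_zero)

lemma neg_imp_one_imp: "\<lbrakk>x \<in> C; y \<in> C\<rbrakk> \<Longrightarrow> \<sim>(x \<leadsto> (\<sim>\<zero> \<leadsto> y)) = \<sim>(x \<leadsto> y)"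
  using neg_imp[of x "\<sim>\<zero> \<leadsto> y"] neg_imp[of x y] by (simp add: neg_neg_one_imp)

text \<open>Expanded by \<open>imp_imp\<close>, the product contains \<open>y\<close> only in
  \<open>\<sim>\<sim>y\<close> and in \<open>\<sim>(x \<leadsto> y)\<close>; neither changes when
  \<open>y\<close> becomes \<open>\<sim>\<zero> \<leadsto> y\<close>.\<close>

lemma zero_imp_one_imp:
  assumes "x \<in> C" "y \<in> C"
  shows "(\<zero> \<leadsto> x) \<leadsto> (\<sim>\<zero> \<leadsto> y) = (\<zero> \<leadsto> x) \<leadsto> y"
  using assms imp_imp[of \<zero> x "\<sim>\<zero> \<leadsto> y"] imp_imp[of \<zero> x y]
  by (simp add: neg_neg_one_imp neg_imp_one_imp)

lemma neg_one_imp_imp: "\<lbrakk>x \<in> C; y \<in> C\<rbrakk> \<Longrightarrow> \<sim>((\<sim>\<zero> \<leadsto> x) \<leadsto> y) = \<sim>(x \<leadsto> y)"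
  using neg_imp[of "\<sim>\<zero> \<leadsto> x" y] zero_imp_one_imp[of \<zero> x] neg_imp[of x y] by simp

lemma neg_imp_neg_neg: "\<lbrakk>x \<in> C; y \<in> C\<rbrakk> \<Longrightarrow> \<sim>(x \<leadsto> \<sim>\<sim>y) = \<sim>(x \<leadsto> y)"
  using neg_one_imp_imp[of x "\<sim>\<sim>y"] neg_imp[of x y] by simp

lemma neg4: "x \<in> C \<Longrightarrow> \<sim>\<sim>\<sim>\<sim>x = \<sim>\<sim>x"
  using neg_neg_one_imp[of "\<sim>\<sim>x"] neg_imp_neg_neg[of "\<sim>\<zero>" x] neg_neg_one_imp[of x] by simp

lemma zero_imp_neg_neg: "\<lbrakk>x \<in> C; y \<in> C\<rbrakk> \<Longrightarrow> (\<zero> \<leadsto> x) \<leadsto> \<sim>\<sim>y = (\<zero> \<leadsto> x) \<leadsto> y"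
  using imp_imp[of \<zero> x "\<sim>\<sim>y"] imp_imp[of \<zero> x y] by (simp add: neg4 neg_imp_neg_neg)

lemma neg_neg_neg_imp: "\<lbrakk>x \<in> C; y \<in> C\<rbrakk> \<Longrightarrow> \<sim>(\<sim>\<sim>x \<leadsto> y) = \<sim>(x \<leadsto> y)"
  using neg_one_imp_imp[of "\<sim>\<sim>x" y] zero_imp_neg_neg[of \<zero> x] neg_one_imp_imp[of x y] by simp

text \<open>By \<open>imp_imp\<close> a left-nested product is the negation of another left-nested
  product, hence a double negation, and \<open>neg4\<close> applies.\<close>

lemma neg_neg_imp_imp:
  assumes "x \<in> C" "y \<in> C" "z \<in> C"
  shows "\<sim>\<sim>((x \<leadsto> y) \<leadsto> z) = (x \<leadsto> y) \<leadsto> z"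
proof -
  have neg3: "\<sim>\<sim>\<sim>((a \<leadsto> b) \<leadsto> c) = \<sim>((a \<leadsto> b) \<leadsto> c)" if "a \<in> C" "b \<in> C" "c \<in> C" for a b c
    using that imp_imp[of a b c] neg4 by simp
  show ?thesis
    using assms imp_imp[of x y z] neg3[of "\<sim>z" x "\<sim>(y \<leadsto> z)"] by simp
qed

lemma imp_imp_neg_neg:
  assumes "x \<in> C" "y \<in> C" "z \<in> C"
  shows "(\<sim>\<sim>x \<leadsto> \<sim>\<sim>y) \<leadsto> \<sim>\<sim>z = (x \<leadsto> y) \<leadsto> z"
proof -
  have "(\<sim>\<sim>x \<leadsto> \<sim>\<sim>y) \<leadsto> \<sim>\<sim>z = \<sim>((\<sim>\<sim>\<sim>z \<leadsto> \<sim>\<sim>x) \<leadsto> \<sim>(\<sim>\<sim>y \<leadsto> \<sim>\<sim>z))"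
    using assms imp_imp[of "\<sim>\<sim>x" "\<sim>\<sim>y" "\<sim>\<sim>z"] by simp
  also have "\<dots> = \<sim>(\<sim>\<sim>(\<sim>\<sim>\<sim>z \<leadsto> \<sim>\<sim>x) \<leadsto> \<sim>(y \<leadsto> z))"
    using assms neg_neg_neg_imp[of "\<sim>\<sim>\<sim>z \<leadsto> \<sim>\<sim>x" "\<sim>(y \<leadsto> z)"]
    by (simp add: neg_neg_neg_imp[of y "\<sim>\<sim>z"] neg_imp_neg_neg[of y z])
  also have "\<sim>\<sim>(\<sim>\<sim>\<sim>z \<leadsto> \<sim>\<sim>x) = \<sim>\<sim>(\<sim>z \<leadsto> x)"
    using assms neg_neg_neg_imp[of "\<sim>z" x] by (simp add: neg_imp_neg_neg)
  also have "\<sim>(\<sim>\<sim>(\<sim>z \<leadsto> x) \<leadsto> \<sim>(y \<leadsto> z)) = (x \<leadsto> y) \<leadsto> z"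
    using assms imp_imp[of x y z] by (simp add: neg_neg_neg_imp)
  finally show ?thesis .
qed

end

section \<open>Commutative involutive zroupoids\<close>

locale involutive_I_zroupoid = I_zroupoid +
  assumes neg_neg [simp]: "x \<in> C \<Longrightarrow> (x \<leadsto> \<zero>) \<leadsto> \<zero> = x"
begin

lemma one_imp [simp]: "x \<in> C \<Longrightarrow> \<sim>\<zero> \<leadsto> x = x"
  using neg_neg_one_imp[of x] by simp

lemma neg_inj: "\<lbrakk>\<sim>x = \<sim>y; x \<in> C; y \<in> C\<rbrakk> \<Longrightarrow> x = y"
  using neg_neg by metis

context
  assumes comm: "\<And>x y. x \<in> C \<Longrightarrow> y \<in> C \<Longrightarrow> x \<leadsto> y = y \<leadsto> x"
begin

text \<open>Expanding \<open>(\<zero> \<leadsto> \<zero>) \<leadsto> a\<close> and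
  \<open>(\<sim>\<zero> \<leadsto> \<zero>) \<leadsto> a\<close> gives
  \<open>a \<leadsto> a = \<sim>a\<close> and then \<open>\<sim>a \<leadsto> a = a\<close>. The
  latter at \<open>x\<close> and at \<open>\<sim>x\<close> evaluates the same product, up to
  commutativity, to \<open>x\<close> and to \<open>\<sim>x\<close>.\<close>

lemma comm_neg:
  assumes "x \<in> C"
  shows "\<sim>x = x"
proof -
  have sq: "a \<leadsto> a = \<sim>a" if "a \<in> C" for a
    using imp_imp[of \<zero> \<zero> a] that comm[of \<zero> a] comm[of \<zero> "\<sim>a"] comm[of "\<sim>a" a]
       neg_inj[of "a \<leadsto> a" "\<sim>a"] by simp
  have "\<sim>a \<leadsto> a = a" if "a \<in> C" for a
    using imp_imp[of "\<sim>\<zero>" \<zero> a] that comm[of \<zero> a] comm[of "\<sim>a" "\<sim>\<zero>"] sq[of a]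
      neg_inj[of "\<sim>a \<leadsto> a" a] by simp
  then have "\<sim>x \<leadsto> x = x" "x \<leadsto> \<sim>x = \<sim>x"
    using assms neg_neg imp_closed zero_closed by metis+
  then show ?thesis using comm[of x "\<sim>x"] assms by simp
qed

text \<open>Negation is the identity by \<open>comm_neg\<close>, so \<open>imp_imp\<close> becomes
  the distributive law \<open>dist\<close>. It reduces the claim to
  \<open>R \<leadsto> Q = Q \<leadsto> P\<close> for the three cyclic products \<open>P\<close>,
  \<open>Q\<close>, \<open>R\<close>.\<close>

lemma comm_rotate:
  assumes "x \<in> C" "y \<in> C" "z \<in> C"
  shows "(x \<leadsto> y) \<leadsto> z = (z \<leadsto> x) \<leadsto> y"
proof -
  have dist: "(a \<leadsto> b) \<leadsto> c = (c \<leadsto> a) \<leadsto> (b \<leadsto> c)" if "a \<in> C" "b \<in> C" "c \<in> C" for a b c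
    using imp_imp[of a b c] that by (simp add: comm_neg)
  have absorb: "a \<leadsto> (a \<leadsto> b) = a \<leadsto> b" if "a \<in> C" "b \<in> C" for a b
    using dist[of \<zero> b a] that comm[of \<zero> b] comm[of "a \<leadsto> b" a] comm[of a b] by (simp add: comm_neg)
  define P Q R where "P = x \<leadsto> y" and "Q = y \<leadsto> z" and "R = z \<leadsto> x"
  note defs = P_def Q_def R_def
  have closed [simp]: "P \<in> C" "Q \<in> C" "R \<in> C" using assms by (simp_all add: defs)
  have Pz: "P \<leadsto> z = R \<leadsto> Q" and Qx: "Q \<leadsto> x = P \<leadsto> R" and Ry: "R \<leadsto> y = Q \<leadsto> P"
    unfolding defs using assms by (blast intro: dist)+
  \<comment> \<open>For example, \<open>R \<leadsto> Q\<close> equals \<open>P \<leadsto> z\<close>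
    and therefore absorbs \<open>P\<close>.\<close>
  have abs': "P \<leadsto> (R \<leadsto> Q) = R \<leadsto> Q" "Q \<leadsto> (P \<leadsto> R) = P \<leadsto> R" "R \<leadsto> (Q \<leadsto> P) = Q \<leadsto> P"
    using absorb[of P z] absorb[of Q x] absorb[of R y] assms Pz Qx Ry by simp_all
  have e1: "Q \<leadsto> P = (R \<leadsto> P) \<leadsto> (Q \<leadsto> R)"
    using dist[of P Q R] comm[of "P \<leadsto> Q" R] comm[of P Q] abs'(3) by simp
  have e2: "R \<leadsto> Q = (P \<leadsto> Q) \<leadsto> (R \<leadsto> P)"
    using dist[of Q R P] comm[of "Q \<leadsto> R" P] comm[of Q R] abs'(1) by simp
  have "R \<leadsto> Q = (R \<leadsto> P) \<leadsto> ((R \<leadsto> P) \<leadsto> (Q \<leadsto> R))"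
    using e1 e2 comm[of "P \<leadsto> Q" "R \<leadsto> P"] comm[of P Q] by simp
  also have "\<dots> = Q \<leadsto> P"
    using e1 absorb by simp
  finally have "P \<leadsto> z = R \<leadsto> y" using Pz Ry by simp
  then show ?thesis by (simp add: defs)
qed

end

end

section \<open>Exchange law in De Morgan algebras\<close>

context I_zroupoid
begin

text \<open>
  With \<open>a \<or> b = a' \<rightarrow> b\<close> the claim is \<open>x' \<or> (y' \<or> z) = y' \<or> (x' \<or> z)\<close>; both sides are the least upper bound
  of the same three elements because of distributivity and absorption.
\<close>

lemma DM_exchange:
  assumes dm: "\<And>x y. x \<in> C \<Longrightarrow> y \<in> C \<Longrightarrow> (x \<leadsto> y) \<leadsto> x = x"
    and xyz: "x \<in> C" "y \<in> C" "z \<in> C"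
  shows "x \<leadsto> (y \<leadsto> z) = y \<leadsto> (x \<leadsto> z)"
proof -
  interpret involutive_I_zroupoid C arrow null
  proof
    fix x assume "x \<in> C"
    \<comment> \<open>By \<open>dm\<close>, every element is a left-nested product and so is fixed
      by double negation.\<close>
    then show "\<sim>\<sim>x = x" using neg_neg_imp_imp[of x x x] dm[of x x] by simp
  qed
  have zero_imp: "\<zero> \<leadsto> a = \<sim>\<zero>" if "a \<in> C" for a
    using dm[of \<zero> a] neg_neg[of "\<zero> \<leadsto> a"] that by simp
  have contrapos: "\<sim>a \<leadsto> b = \<sim>b \<leadsto> a" if "a \<in> C" "b \<in> C" for a b
    using imp_imp[of a \<zero> b] that zero_imp[of b] by simp
  define join where "join a b = \<sim>a \<leadsto> b" for a b
  define meet where "meet a b = \<sim>(a \<leadsto> \<sim>b)" for a b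
  have closed [simp]: "join a b \<in> C" "meet a b \<in> C" if "a \<in> C" "b \<in> C" for a b
    using that by (simp_all add: join_def meet_def)
  have join_comm: "join a b = join b a" if "a \<in> C" "b \<in> C" for a b
    using that contrapos by (simp add: join_def)
  have contrapos': "a \<leadsto> \<sim>b = b \<leadsto> \<sim>a" if "a \<in> C" "b \<in> C" for a b
    using contrapos[of "\<sim>a" "\<sim>b"] that by simp
  then have meet_comm: "meet a b = meet b a" if "a \<in> C" "b \<in> C" for a b
    using that by (simp add: meet_def)
  have join_meet: "join (meet a b) a = a" if "a \<in> C" "b \<in> C" for a b
    using that dm[of a "\<sim>b"] by (simp add: join_def meet_def)
  have meet_join: "meet a (join a b) = a" if "a \<in> C" "b \<in> C" for a b
    using that contrapos'[of a "\<sim>a \<leadsto> b"] dm[of "\<sim>a" b] by (simp add: join_def meet_def)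
  \<comment> \<open>This is \<open>imp_imp\<close> at \<open>\<sim>a\<close>, \<open>b\<close>,
    \<open>\<sim>c\<close>, rewritten by contraposition.\<close>
  have meet_join_distrib: "meet c (join a b) = join (meet c a) (meet c b)"
    if "a \<in> C" "b \<in> C" "c \<in> C" for a b c
    using that contrapos'[of c "\<sim>a \<leadsto> b"] contrapos'[of c b] imp_imp[of "\<sim>a" b "\<sim>c"]
    by (simp add: join_def meet_def)
  have meets: "meet a (join a (join b c)) = a" "meet b (join a (join b c)) = b"
      "meet c (join a (join b c)) = c" if "a \<in> C" "b \<in> C" "c \<in> C" for a b c
    using that meet_join[of b c] meet_join[of c b] join_comm[of b c]
      meet_join_distrib[of a "join b c" b] meet_join_distrib[of a "join b c" c]
    by (simp_all add: meet_join join_meet)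
  \<comment> \<open>Distributing the meet over the second join leaves \<open>a\<close>,
    \<open>b\<close>, \<open>c\<close> by \<open>meets\<close>, so the second join lies below the
    first. Exchanging \<open>a\<close> and \<open>b\<close> gives the converse.\<close>
  have join_le: "meet (join a (join b c)) (join b (join a c)) = join b (join a c)"
    if "a \<in> C" "b \<in> C" "c \<in> C" for a b c
    using that meets[of a b c]
    by (simp add: meet_join_distrib[of b] meet_join_distrib[of a c] meet_comm[of "join a (join b c)"])
  have "join a (join b c) = join b (join a c)" if "a \<in> C" "b \<in> C" "c \<in> C" for a b c
    using that join_le[of a b c] join_le[of b a c] meet_comm[of "join a (join b c)" "join b (join a c)"]
    by simp
  from this[of "\<sim>x" "\<sim>y" z] show ?thesis using xyz by (simp add: join_def)
qed

end

section \<open>Classification of identities of associative type up to renaming\<close>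

definition identity_A :: "nat \<Rightarrow> identity" where
  "identity_A k = assoc_identities ! (k - 1)"

lemma satisfies_identity_A:
  assumes "k \<in> {1..14}"
  shows "A \<Turnstile> identity_A k \<longleftrightarrow>
    (\<forall>x\<in>carrier A. \<forall>y\<in>carrier A. \<forall>z\<in>carrier A.
      (let op = imp A in
       [op x (op y z) = op (op x y) z,
        op x (op y z) = op x (op z y),
        op x (op y z) = op (op x z) y,
        op x (op y z) = op y (op x z),
        op x (op y z) = op (op y x) z,
        op x (op y z) = op y (op z x),
        op x (op y z) = op (op y z) x,
        op x (op y z) = op (op z x) y,
        op x (op y z) = op z (op y x),
        op x (op y z) = op (op z y) x,
        op (op x y) z = op (op x z) y,
        op (op x y) z = op (op y x) z,
        op (op x y) z = op (op y z) x,
        op (op x y) z = op (op z y) x] ! (k - 1)))"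
proof -
  have "k \<in> {1, 2, 3, 4, 5, 6, 7, 8, 9, 10, 11, 12, 13, 14}" using assms by (simp, presburger)
  then show ?thesis
    unfolding identity_A_def assoc_identities_def Let_def
    by (elim insertE emptyE) (simp_all add: satisfies_XYZ del: satisfies.simps)
qed

lemma satisfies_sym: "A \<Turnstile> (p \<approx> q) \<longleftrightarrow> A \<Turnstile> (q \<approx> p)"
  by auto

text \<open>Names of variables are immaterial: both sides unfold to the same statement about three
  carrier elements.\<close>

lemma satisfies_assoc_type:
  fixes A :: "'a zroupoid"
  assumes "distinct [a, b, c]"
  shows "A \<Turnstile> (Var a \<rightarrow> (Var b \<rightarrow> Var c) \<approx> (Var a \<rightarrow> Var b) \<rightarrow> Var c) \<longleftrightarrow> A \<Turnstile> identity_A 1"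
    "A \<Turnstile> (Var a \<rightarrow> (Var b \<rightarrow> Var c) \<approx> Var a \<rightarrow> (Var c \<rightarrow> Var b)) \<longleftrightarrow> A \<Turnstile> identity_A 2"
    "A \<Turnstile> (Var a \<rightarrow> (Var b \<rightarrow> Var c) \<approx> (Var a \<rightarrow> Var c) \<rightarrow> Var b) \<longleftrightarrow> A \<Turnstile> identity_A 3"
    "A \<Turnstile> (Var a \<rightarrow> (Var b \<rightarrow> Var c) \<approx> Var b \<rightarrow> (Var a \<rightarrow> Var c)) \<longleftrightarrow> A \<Turnstile> identity_A 4"
    "A \<Turnstile> (Var a \<rightarrow> (Var b \<rightarrow> Var c) \<approx> (Var b \<rightarrow> Var a) \<rightarrow> Var c) \<longleftrightarrow> A \<Turnstile> identity_A 5"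
    "A \<Turnstile> (Var a \<rightarrow> (Var b \<rightarrow> Var c) \<approx> Var b \<rightarrow> (Var c \<rightarrow> Var a)) \<longleftrightarrow> A \<Turnstile> identity_A 6"
    "A \<Turnstile> (Var a \<rightarrow> (Var b \<rightarrow> Var c) \<approx> (Var b \<rightarrow> Var c) \<rightarrow> Var a) \<longleftrightarrow> A \<Turnstile> identity_A 7"
    "A \<Turnstile> (Var a \<rightarrow> (Var b \<rightarrow> Var c) \<approx> (Var c \<rightarrow> Var a) \<rightarrow> Var b) \<longleftrightarrow> A \<Turnstile> identity_A 8"
    "A \<Turnstile> (Var a \<rightarrow> (Var b \<rightarrow> Var c) \<approx> Var c \<rightarrow> (Var b \<rightarrow> Var a)) \<longleftrightarrow> A \<Turnstile> identity_A 9"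
    "A \<Turnstile> (Var a \<rightarrow> (Var b \<rightarrow> Var c) \<approx> (Var c \<rightarrow> Var b) \<rightarrow> Var a) \<longleftrightarrow> A \<Turnstile> identity_A 10"
    "A \<Turnstile> ((Var a \<rightarrow> Var b) \<rightarrow> Var c \<approx> (Var a \<rightarrow> Var c) \<rightarrow> Var b) \<longleftrightarrow> A \<Turnstile> identity_A 11"
    "A \<Turnstile> ((Var a \<rightarrow> Var b) \<rightarrow> Var c \<approx> (Var b \<rightarrow> Var a) \<rightarrow> Var c) \<longleftrightarrow> A \<Turnstile> identity_A 12"
    "A \<Turnstile> ((Var a \<rightarrow> Var b) \<rightarrow> Var c \<approx> (Var b \<rightarrow> Var c) \<rightarrow> Var a) \<longleftrightarrow> A \<Turnstile> identity_A 13"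
    "A \<Turnstile> ((Var a \<rightarrow> Var b) \<rightarrow> Var c \<approx> (Var c \<rightarrow> Var b) \<rightarrow> Var a) \<longleftrightarrow> A \<Turnstile> identity_A 14"
  using assms
  by (simp_all add: satisfies_iff[of a b c] satisfies_XYZ identity_A_def assoc_identities_def
      del: satisfies.simps)

lemma distinct_insert_eq_cases:
  assumes "{a, b, c} = {x, y, z}" "distinct [x, y, z]"
  shows "(a = x \<and> b = y \<and> c = z) \<or> (a = x \<and> b = z \<and> c = y) \<or> (a = y \<and> b = x \<and> c = z) \<or>
    (a = y \<and> b = z \<and> c = x) \<or> (a = z \<and> b = x \<and> c = y) \<or> (a = z \<and> b = y \<and> c = x)"
proof -
  have "a \<in> {x, y, z}" "b \<in> {x, y, z}" "c \<in> {x, y, z}" "{x, y, z} \<subseteq> {a, b, c}"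
    using assms(1) by auto
  then show ?thesis using assms(2) by auto
qed

text \<open>Once one side has its variables in standard order, the other is given by a bracketing
  and a permutation. If the bracketings differ, the right-nested side is put first: six identities.
  If they agree, five nontrivial permutations remain for each bracketing, two of which are inverse
  3-cycles.\<close>

lemma assoc_type_identityD:
  assumes "assoc_type_identity e"
  shows "\<exists>k\<in>{1..14}. \<forall>A :: 'a zroupoid. A \<Turnstile> e \<longleftrightarrow> A \<Turnstile> identity_A k"
proof -
  \<comment> \<open>The inverse 3-cycle becomes (A6) or (A13) when the two sides are swapped and the
    variables renamed.\<close>
  have rot: "A \<Turnstile> (Var a \<rightarrow> (Var b \<rightarrow> Var c) \<approx> Var c \<rightarrow> (Var a \<rightarrow> Var b)) \<longleftrightarrow> A \<Turnstile> identity_A 6"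
    "A \<Turnstile> ((Var a \<rightarrow> Var b) \<rightarrow> Var c \<approx> (Var c \<rightarrow> Var a) \<rightarrow> Var b) \<longleftrightarrow> A \<Turnstile> identity_A 13"
    if "distinct [a, b, c]" for a b c and A :: "'a zroupoid"
    using satisfies_assoc_type(6,13)[of c a b A] that
    by (metis distinct_length_2_or_more distinct_singleton satisfies_sym)+
  note laws = satisfies_assoc_type rot
  have left: "\<exists>k\<in>{1..14}. \<forall>A :: 'a zroupoid. A \<Turnstile> (p \<approx> q) \<longleftrightarrow> A \<Turnstile> identity_A k"
    if p: "p = Var a \<rightarrow> (Var b \<rightarrow> Var c)"
      and q: "q = Var d \<rightarrow> (Var e \<rightarrow> Var f) \<or> q = (Var d \<rightarrow> Var e) \<rightarrow> Var f"
      and "p \<noteq> q" and abc: "distinct [a, b, c]" and perm: "{d, e, f} = {a, b, c}"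
    for p q a b c d e f
  proof -
    note q' = q distinct_insert_eq_cases[OF perm abc] \<open>p \<noteq> q\<close> p
    have "\<exists>k\<in>{1, 2, 3, 4, 5, 6, 7, 8, 9, 10}. \<forall>A :: 'a zroupoid. A \<Turnstile> (p \<approx> q) \<longleftrightarrow> A \<Turnstile> identity_A k"
      using q' by (elim disjE conjE) (simp_all add: laws[OF abc] del: satisfies.simps distinct.simps)
    then show ?thesis by (elim bexE) (rule bexI, assumption, auto)
  qed
  have right: "\<exists>k\<in>{1..14}. \<forall>A :: 'a zroupoid. A \<Turnstile> (p \<approx> q) \<longleftrightarrow> A \<Turnstile> identity_A k"
    if p: "p = (Var a \<rightarrow> Var b) \<rightarrow> Var c" and q: "q = (Var d \<rightarrow> Var e) \<rightarrow> Var f"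
      and "p \<noteq> q" and abc: "distinct [a, b, c]" and perm: "{d, e, f} = {a, b, c}"
    for p q a b c d e f
  proof -
    note q' = distinct_insert_eq_cases[OF perm abc] \<open>p \<noteq> q\<close> p q
    have "\<exists>k\<in>{11, 12, 13, 14}. \<forall>A :: 'a zroupoid. A \<Turnstile> (p \<approx> q) \<longleftrightarrow> A \<Turnstile> identity_A k"
      using q' by (elim disjE conjE) (simp_all add: laws[OF abc] del: satisfies.simps distinct.simps)
    then show ?thesis by (elim bexE) (rule bexI, assumption, auto)
  qed
  obtain p q x y z a b c a' b' c' where e: "e = (p \<approx> q)" and "p \<noteq> q" and "distinct [x, y, z]"
    and abc: "{a, b, c} = {x, y, z}" and p: "p = Var a \<rightarrow> (Var b \<rightarrow> Var c) \<or> p = (Var a \<rightarrow> Var b) \<rightarrow> Var c"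
    and perm': "{a', b', c'} = {x, y, z}" and q: "q = Var a' \<rightarrow> (Var b' \<rightarrow> Var c') \<or> q = (Var a' \<rightarrow> Var b') \<rightarrow> Var c'"
    using assms unfolding assoc_type_identity_def assoc_type_trm_def by blast
  have distinct: "distinct [a, b, c]" "distinct [a', b', c']"
    using distinct_insert_eq_cases[OF abc] distinct_insert_eq_cases[OF perm'] \<open>distinct [x, y, z]\<close> by auto
  show ?thesis
    using p
  proof
    assume "p = Var a \<rightarrow> (Var b \<rightarrow> Var c)"
    from left[OF this q \<open>p \<noteq> q\<close> distinct(1)] show ?thesis using abc perm' e by simp
  next
    assume p': "p = (Var a \<rightarrow> Var b) \<rightarrow> Var c"
    from q show ?thesis
    proof
      assume "q = Var a' \<rightarrow> (Var b' \<rightarrow> Var c')"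
      from left[OF this p \<open>p \<noteq> q\<close>[symmetric] distinct(2)] show ?thesis
        using abc perm' e by (simp add: satisfies_sym[of _ p q] del: satisfies.simps)
    next
      assume "q = (Var a' \<rightarrow> Var b') \<rightarrow> Var c'"
      from right[OF p' this \<open>p \<noteq> q\<close> distinct(1)] show ?thesis using abc perm' e by simp
    qed
  qed
qed

section \<open>Symmetry of left-nested products\<close>

lemma satisfies_subalgebra:
  assumes "A \<Turnstile> e" "D \<subseteq> carrier A"
  shows "A\<lparr>carrier := D\<rparr> \<Turnstile> e"
proof -
  have "eval (A\<lparr>carrier := D\<rparr>) v t = eval A v t" for v t
    by (induction t) auto
  then show ?thesis using assms by (cases e) auto
qed

text \<open>Substituting the left unit \<open>\<sim>\<zero>\<close> for one variable gives
  commutativity; (A5), (A8), (A10) and (A13) first make \<open>\<sim>\<zero>\<close> a right unit.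
  For (A12), z = 0 and injectivity of negation suffice.\<close>

lemma (in involutive_I_zroupoid) comm_if_assoc_type:
  assumes "k \<in> {2, 3, 5, 6, 7, 8, 9, 10, 11, 12, 13}" and "alg \<Turnstile> identity_A k"
    and "x \<in> C" "y \<in> C"
  shows "x \<leadsto> y = y \<leadsto> x"
proof -
  note law = satisfies_identity_A[of _ alg, THEN iffD1, simplified Let_def zroupoid.simps, rule_format]
  consider "k = 2" | "k = 3" | "k = 5" | "k = 6" | "k = 7" | "k = 8" | "k = 9" | "k = 10"
    | "k = 11" | "k = 12" | "k = 13"
    using assms(1) by auto
  then show ?thesis
  proof cases
    case 1
    then show ?thesis using assms law[of 2 "\<sim>\<zero>" x y] by simp
  next
    case 2
    then show ?thesis using assms law[of 3 "\<sim>\<zero>" x y] by simp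
  next
    case 3
    then have law: "a \<leadsto> (b \<leadsto> c) = (b \<leadsto> a) \<leadsto> c" if "a \<in> C" "b \<in> C" "c \<in> C" for a b c
      using assms law[of 5 a b c] that by simp
    have "b \<leadsto> \<sim>\<zero> = b" if "b \<in> C" for b
      using law[of "\<sim>\<zero>" b \<zero>] that neg_inj[of "b \<leadsto> \<sim>\<zero>" b] by simp
    then show ?thesis using law[of x y "\<sim>\<zero>"] assms by simp
  next
    case 4
    then show ?thesis using assms law[of 6 x "\<sim>\<zero>" y] by simp
  next
    case 5
    then show ?thesis using assms law[of 7 x "\<sim>\<zero>" y] by simp
  next
    case 6
    then have law: "a \<leadsto> (b \<leadsto> c) = (c \<leadsto> a) \<leadsto> b" if "a \<in> C" "b \<in> C" "c \<in> C" for a b c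
      using assms law[of 8 a b c] that by simp
    \<comment> \<open>The right unit law is reached in stages: at \<open>\<zero>\<close>, then
      \<open>\<zero> \<leadsto> b = \<sim>b\<close>, then a law for negated products.\<close>
    have "\<zero> \<leadsto> \<sim>\<zero> = \<zero>"
      using law[of "\<sim>\<zero>" \<zero> \<zero>] neg_inj[of "\<zero> \<leadsto> \<sim>\<zero>" \<zero>] by simp
    then have "\<zero> \<leadsto> b = \<sim>b" if "b \<in> C" for b
      using law[of "\<sim>\<zero>" b \<zero>] that by simp
    then have neg_imp: "\<sim>(b \<leadsto> c) = \<sim>c \<leadsto> b" if "b \<in> C" "c \<in> C" for b c
      using law[of \<zero> b c] that by simp
    have "b \<leadsto> \<sim>\<zero> = b" if "b \<in> C" for b
      using neg_imp[of "\<sim>\<zero>" "\<sim>b"] that by simp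
    then show ?thesis using law[of x "\<sim>\<zero>" y] assms by simp
  next
    case 7
    then show ?thesis using assms law[of 9 x "\<sim>\<zero>" y] by simp
  next
    case 8
    then have law: "a \<leadsto> (b \<leadsto> c) = (c \<leadsto> b) \<leadsto> a" if "a \<in> C" "b \<in> C" "c \<in> C" for a b c
      using assms law[of 10 a b c] that by simp
    have "b \<leadsto> \<sim>\<zero> = b" if "b \<in> C" for b
      using law[of b "\<sim>\<zero>" "\<sim>\<zero>"] that by simp
    then show ?thesis using law[of x y "\<sim>\<zero>"] assms by simp
  next
    case 9
    then show ?thesis using assms law[of 11 "\<sim>\<zero>" x y] by simp
  next
    case 10
    then show ?thesis using assms law[of 12 x y \<zero>] neg_inj[of "x \<leadsto> y" "y \<leadsto> x"] by simp
  next
    case 11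
    then show ?thesis using assms law[of 13 x "\<sim>\<zero>" y] law[of 13 "\<sim>\<zero>" "\<sim>\<zero>" x] by simp
  qed
qed

context I_zroupoid
begin

text \<open>The two equations are a transposition and a 3-cycle, which generate all permutations of
  the factors.\<close>

definition left_symmetric :: bool where
  "left_symmetric \<longleftrightarrow> (\<forall>x\<in>C. \<forall>y\<in>C. \<forall>z\<in>C.
     (x \<leadsto> y) \<leadsto> z = (y \<leadsto> x) \<leadsto> z \<and> (x \<leadsto> y) \<leadsto> z = (z \<leadsto> x) \<leadsto> y)"

lemma left_symmetric_if_assoc_type:
  assumes k: "k \<in> {2, 3, 5, 6, 7, 8, 9, 10, 11, 12, 13}" and law: "alg \<Turnstile> identity_A k"
  shows left_symmetric
proof -
  \<comment> \<open>The involutive elements form a subalgebra, to which the locale results apply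
    with carrier \<open>D\<close>.\<close>
  define D where "D = {x \<in> C. \<sim>\<sim>x = x}"
  have D: "involutive_I_zroupoid D arrow null"
  proof
    \<comment> \<open>Writing \<open>x\<close> as \<open>\<sim>\<sim>x\<close> turns
      \<open>x \<leadsto> y\<close> into a left-nested product.\<close>
    show "x \<leadsto> y \<in> D" if "x \<in> D" "y \<in> D" for x y
      using that neg_neg_imp_imp[of "\<sim>x" \<zero> y] by (simp add: D_def)
    show "(x \<leadsto> y) \<leadsto> z = \<sim>((\<sim>z \<leadsto> x) \<leadsto> \<sim>(y \<leadsto> z))" if "x \<in> D" "y \<in> D" "z \<in> D" for x y z
      using that by (intro imp_imp) (simp_all add: D_def)
    show "\<zero> \<in> D" by (simp add: D_def zero_zero_zero)
    show "\<sim>\<sim>\<zero> = \<zero>" by (rule zero_zero_zero)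
    show "\<sim>\<sim>x = x" if "x \<in> D" for x using that by (simp add: D_def)
  qed
  have "D \<subseteq> C" by (auto simp: D_def)
  have "\<lparr>carrier = D, imp = (\<leadsto>), zero = \<zero>\<rparr> \<Turnstile> identity_A k"
    using satisfies_subalgebra[OF law, of D] \<open>D \<subseteq> C\<close> by simp
  from involutive_I_zroupoid.comm_if_assoc_type[OF D k this] have comm: "x \<leadsto> y = y \<leadsto> x" if "x \<in> D" "y \<in> D" for x y
    using that by blast
  show ?thesis
    unfolding left_symmetric_def
  proof (intro ballI)
    fix x y z assume xyz: "x \<in> C" "y \<in> C" "z \<in> C"
    then have in_D: "\<sim>\<sim>x \<in> D" "\<sim>\<sim>y \<in> D" "\<sim>\<sim>z \<in> D" by (simp_all add: D_def neg4)
    \<comment> \<open>By \<open>imp_imp_neg_neg\<close> each factor may be replaced by its double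
      negation, which lies in \<open>D\<close>.\<close>
    show "(x \<leadsto> y) \<leadsto> z = (y \<leadsto> x) \<leadsto> z \<and> (x \<leadsto> y) \<leadsto> z = (z \<leadsto> x) \<leadsto> y"
      using arg_cong[OF comm[OF in_D(1,2)], of "\<lambda>w. w \<leadsto> \<sim>\<sim>z"] involutive_I_zroupoid.comm_rotate[OF D comm in_D]
      by (simp only: imp_imp_neg_neg xyz simp_thms)
  qed
qed

lemma left_symmetricD:
  assumes left_symmetric "x \<in> C" "y \<in> C" "z \<in> C"
  shows "(x \<leadsto> y) \<leadsto> z = (y \<leadsto> x) \<leadsto> z" "(x \<leadsto> z) \<leadsto> y = (x \<leadsto> y) \<leadsto> z"
    "(y \<leadsto> z) \<leadsto> x = (x \<leadsto> y) \<leadsto> z" "(z \<leadsto> x) \<leadsto> y = (x \<leadsto> y) \<leadsto> z" "(z \<leadsto> y) \<leadsto> x = (x \<leadsto> y) \<leadsto> z"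
proof -
  note sym = assms(1)[unfolded left_symmetric_def, rule_format]
  from assms show "(x \<leadsto> y) \<leadsto> z = (y \<leadsto> x) \<leadsto> z" "(x \<leadsto> z) \<leadsto> y = (x \<leadsto> y) \<leadsto> z"
    "(y \<leadsto> z) \<leadsto> x = (x \<leadsto> y) \<leadsto> z" "(z \<leadsto> x) \<leadsto> y = (x \<leadsto> y) \<leadsto> z" "(z \<leadsto> y) \<leadsto> x = (x \<leadsto> y) \<leadsto> z"
    using sym[of x y z] sym[of z x y] sym[of y z x] by metis+
qed

end

section \<open>Coincidences and inclusions among the varieties\<close>

lemma zroupoid_collapse [simp]:
  "\<lparr>carrier = carrier A, imp = imp A, zero = zero A\<rparr> = (A :: 'a zroupoid)"
  by simp

lemma I_variety_iff: "A \<in> I_variety \<longleftrightarrow> I_zroupoid (carrier A) (imp A) (zero A)"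
proof -
  have "A \<Turnstile> ((X \<rightarrow> Y) \<rightarrow> Z \<approx> ((Z\<acute> \<rightarrow> X) \<rightarrow> (Y \<rightarrow> Z)\<acute>)\<acute>) \<longleftrightarrow>
      (\<forall>x\<in>carrier A. \<forall>y\<in>carrier A. \<forall>z\<in>carrier A. imp A (imp A x y) z =
        imp A (imp A (imp A (imp A z (zero A)) x) (imp A (imp A y z) (zero A))) (zero A))"
    by (simp add: satisfies_XYZ del: satisfies.simps)
  \<comment> \<open>Even a closed identity is tested on valuations; an element of the carrier
    provides one.\<close>
  moreover have "A \<Turnstile> (Zero\<acute>\<acute> \<approx> Zero) \<longleftrightarrow> imp A (imp A (zero A) (zero A)) (zero A) = zero A"
    if "zero A \<in> carrier A"
    using that by (auto simp: satisfies_XYZ simp del: satisfies.simps)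
  ultimately show ?thesis
    unfolding I_variety_def subvariety_def algebra_def I_zroupoid_def by blast
qed

context I_zroupoid
begin

lemmas law_iff = satisfies_identity_A[of _ alg, simplified Let_def zroupoid.simps]

lemma left_symmetric_iff:
  assumes "k \<in> {11, 12, 13}"
  shows "alg \<Turnstile> identity_A k \<longleftrightarrow> left_symmetric"
proof
  assume left_symmetric
  then show "alg \<Turnstile> identity_A k"
    using assms by (elim insertE) (simp_all add: law_iff left_symmetricD)
qed (use assms left_symmetric_if_assoc_type[of k] in auto)

lemma identity_A_14:
  assumes left_symmetric
  shows "alg \<Turnstile> identity_A 14"
  using assms by (simp add: law_iff left_symmetricD)

text \<open>Associativity turns right-nested products into left-nested ones, whose factors can be
  permuted freely.\<close>

lemma assoc_left_symmetric:
  assumes left_symmetric and "alg \<Turnstile> identity_A 1"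
    and k: "k \<in> {2, 3, 4, 5, 6, 7, 8, 9, 10}"
  shows "alg \<Turnstile> identity_A k"
proof -
  have assoc: "x \<leadsto> (y \<leadsto> z) = (x \<leadsto> y) \<leadsto> z" if "x \<in> C" "y \<in> C" "z \<in> C" for x y z
    using assms(2) law_iff[of 1] that by simp
  show ?thesis
    using k by (elim insertE) (simp_all add: law_iff assoc left_symmetricD(1,2)[OF assms(1)])
qed

text \<open>These identities equate a right-nested product with a permuted left-nested one; undoing
  the permutation by symmetry leaves (A1).\<close>

lemma assoc_left_symmetric_iff:
  assumes "k \<in> {3, 5, 7, 8, 10}"
  shows "alg \<Turnstile> identity_A k \<longleftrightarrow> left_symmetric \<and> alg \<Turnstile> identity_A 1"
proof
  assume law: "alg \<Turnstile> identity_A k"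
  with assms left_symmetric_if_assoc_type[of k] have left_symmetric by auto
  moreover from this have "alg \<Turnstile> identity_A 1"
    using assms law by (elim insertE) (simp_all add: law_iff left_symmetricD)
  ultimately show "left_symmetric \<and> alg \<Turnstile> identity_A 1" ..
qed (use assms assoc_left_symmetric[of k] in auto)

end

lemma mem_\<A>: "A \<in> \<A> k \<longleftrightarrow> A \<in> I_variety \<and> A \<Turnstile> identity_A k"
  by (simp add: \<A>_def subvariety_def identity_A_def)

lemma \<A>_eq_11:
  assumes "k \<in> {12, 13}"
  shows "(\<A> k :: 'a zroupoid set) = \<A> 11"
proof -
  have "A \<in> \<A> k \<longleftrightarrow> A \<in> \<A> 11" for A :: "'a zroupoid"
    using I_zroupoid.left_symmetric_iff[of "carrier A" "imp A" "zero A" k]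
      I_zroupoid.left_symmetric_iff[of "carrier A" "imp A" "zero A" 11] assms
    by (auto simp: mem_\<A> I_variety_iff)
  then show ?thesis by blast
qed

lemma \<A>_eq_3:
  assumes "k \<in> {5, 7, 8, 10}"
  shows "(\<A> k :: 'a zroupoid set) = \<A> 3"
proof -
  have "A \<in> \<A> k \<longleftrightarrow> A \<in> \<A> 3" for A :: "'a zroupoid"
    using I_zroupoid.assoc_left_symmetric_iff[of "carrier A" "imp A" "zero A" k]
      I_zroupoid.assoc_left_symmetric_iff[of "carrier A" "imp A" "zero A" 3] assms
    by (auto simp: mem_\<A> I_variety_iff)
  then show ?thesis by blast
qed

lemma assoc_type_subvarietyD:
  fixes V :: "'a zroupoid set"
  assumes "assoc_type_subvariety V"
  shows "V \<in> {\<A> 1, \<A> 2, \<A> 3, \<A> 4, \<A> 6, \<A> 9, \<A> 11, \<A> 14}"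
proof -
  obtain e where "assoc_type_identity e" and V: "V = subvariety I_variety {e}"
    using assms by (auto simp: assoc_type_subvariety_def)
  then obtain k where k: "k \<in> {1..14}" and law: "\<forall>A :: 'a zroupoid. A \<Turnstile> e \<longleftrightarrow> A \<Turnstile> identity_A k"
    using assoc_type_identityD by blast
  have "V = \<A> k"
    unfolding V \<A>_def subvariety_def identity_A_def[symmetric] using law by simp
  moreover have "k \<in> {1, 2, 3, 4, 5, 6, 7, 8, 9, 10, 11, 12, 13, 14}" using k by (simp, presburger)
  ultimately show ?thesis using \<A>_eq_3[of k, where 'a = 'a] \<A>_eq_11[of k, where 'a = 'a] by (elim insertE emptyE) simp_all
qed

lemma \<A>_3_subset:
  assumes "k \<in> {1, 2, 4, 6, 9}"
  shows "\<A> 3 \<subseteq> \<A> k"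
proof
  fix A :: "'a zroupoid" assume "A \<in> \<A> 3"
  then show "A \<in> \<A> k"
    using I_zroupoid.assoc_left_symmetric_iff[of "carrier A" "imp A" "zero A" 3]
      I_zroupoid.assoc_left_symmetric[of "carrier A" "imp A" "zero A" k] assms
    by (auto simp: mem_\<A> I_variety_iff)
qed

lemma subset_\<A>_11:
  assumes "k \<in> {2, 6, 9}"
  shows "\<A> k \<subseteq> \<A> 11"
proof
  fix A :: "'a zroupoid" assume "A \<in> \<A> k"
  then show "A \<in> \<A> 11"
    using I_zroupoid.left_symmetric_if_assoc_type[of "carrier A" "imp A" "zero A" k]
      I_zroupoid.left_symmetric_iff[of "carrier A" "imp A" "zero A" 11] assms
    by (auto simp: mem_\<A> I_variety_iff)
qed

lemma \<A>_11_subset: "\<A> 11 \<subseteq> \<A> 14"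
proof
  fix A :: "'a zroupoid" assume "A \<in> \<A> 11"
  then show "A \<in> \<A> 14"
    using I_zroupoid.identity_A_14[of "carrier A" "imp A" "zero A"]
      I_zroupoid.left_symmetric_iff[of "carrier A" "imp A" "zero A" 11]
    by (auto simp: mem_\<A> I_variety_iff)
qed

section \<open>Semilattices and Boolean algebras\<close>

lemma (in involutive_I_zroupoid) comm_identity_A_3:
  assumes comm: "\<And>x y. x \<in> C \<Longrightarrow> y \<in> C \<Longrightarrow> x \<leadsto> y = y \<leadsto> x"
  shows "alg \<Turnstile> identity_A 3"
proof -
  have "x \<leadsto> (y \<leadsto> z) = (x \<leadsto> z) \<leadsto> y" if "x \<in> C" "y \<in> C" "z \<in> C" for x y z
  proof -
    have "x \<leadsto> (y \<leadsto> z) = (y \<leadsto> z) \<leadsto> x" using that by (intro comm) simp_all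
    also have "\<dots> = (x \<leadsto> y) \<leadsto> z" using that by (intro comm_rotate comm)
    also have "\<dots> = (y \<leadsto> x) \<leadsto> z" using that comm[of x y] by simp
    also have "\<dots> = (x \<leadsto> z) \<leadsto> y" using that by (intro comm_rotate[symmetric] comm)
    finally show ?thesis .
  qed
  then show ?thesis by (simp add: law_iff)
qed

lemma SL_subset: "SL_variety \<subseteq> \<A> 3"
proof
  fix A :: "'a zroupoid" assume "A \<in> SL_variety"
  then have A: "A \<in> I_variety"
    and neg: "\<And>x. x \<in> carrier A \<Longrightarrow> imp A x (zero A) = x"
    and comm: "\<And>x y. x \<in> carrier A \<Longrightarrow> y \<in> carrier A \<Longrightarrow> imp A x y = imp A y x"
    by (auto simp: SL_variety_def subvariety_def satisfies_XYZ simp del: satisfies.simps)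
  have "involutive_I_zroupoid (carrier A) (imp A) (zero A)"
    using A by (simp add: I_variety_iff involutive_I_zroupoid_def involutive_I_zroupoid_axioms_def neg)
  from involutive_I_zroupoid.comm_identity_A_3[OF this comm] show "A \<in> \<A> 3"
    using A by (simp add: mem_\<A>)
qed

lemma BA_subset: "BA_variety \<subseteq> \<A> 4"
proof
  fix A :: "'a zroupoid" assume "A \<in> BA_variety"
  then have "A \<in> DM_variety" unfolding BA_variety_def subvariety_def by blast
  then have A: "A \<in> I_variety"
    and dm: "\<And>x y. x \<in> carrier A \<Longrightarrow> y \<in> carrier A \<Longrightarrow> imp A (imp A x y) x = x"
    by (auto simp: DM_variety_def subvariety_def satisfies_XYZ simp del: satisfies.simps)
  from I_zroupoid.DM_exchange[OF A[unfolded I_variety_iff] dm] show "A \<in> \<A> 4"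
    using A by (simp add: mem_\<A> satisfies_identity_A)
qed

section \<open>Finite models separating the varieties\<close>

definition table :: "nat list list \<Rightarrow> nat zroupoid" where
  "table T = \<lparr>carrier = set [0..<length T], imp = (\<lambda>x y. T ! x ! y), zero = 0\<rparr>"

text \<open>The finite models consist of natural numbers, while the theorem concerns an arbitrary
  infinite type. Evaluation commutes with the injection \<open>g\<close>, and every valuation into
  its image lifts.\<close>

lemma ex_copy:
  assumes "infinite (UNIV :: 'a set)" and "algebra (B :: nat zroupoid)"
  shows "\<exists>A :: 'a zroupoid. algebra A \<and> (\<forall>e. A \<Turnstile> e \<longleftrightarrow> B \<Turnstile> e)"
proof -
  obtain g :: "nat \<Rightarrow> 'a" where "inj g"
    using infinite_countable_subset[OF assms(1)] by blast
  define A where "A = \<lparr>carrier = g ` carrier B,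
    imp = (\<lambda>x y. g (imp B (inv g x) (inv g y))), zero = g (zero B)\<rparr>"
  have eval: "eval A (g \<circ> u) t = g (eval B u t)" for u :: "nat \<Rightarrow> nat" and t
    by (induction t) (simp_all add: A_def \<open>inj g\<close>)
  have "A \<Turnstile> (p \<approx> q) \<longleftrightarrow> B \<Turnstile> (p \<approx> q)" for p q
  proof
    assume A: "A \<Turnstile> (p \<approx> q)"
    show "B \<Turnstile> (p \<approx> q)"
      unfolding satisfies.simps
    proof (intro allI impI)
      fix u :: "nat \<Rightarrow> nat" assume "range u \<subseteq> carrier B"
      then have "range (g \<circ> u) \<subseteq> carrier A" by (auto simp: A_def)
      with A have "eval A (g \<circ> u) p = eval A (g \<circ> u) q" by simp
      then show "eval B u p = eval B u q" using \<open>inj g\<close> by (simp add: eval inj_eq)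
    qed
  next
    assume B: "B \<Turnstile> (p \<approx> q)"
    show "A \<Turnstile> (p \<approx> q)"
      unfolding satisfies.simps
    proof (intro allI impI)
      fix v :: "nat \<Rightarrow> 'a" assume v: "range v \<subseteq> carrier A"
      then have "\<forall>i. \<exists>b. b \<in> carrier B \<and> v i = g b" by (auto simp: A_def)
      then obtain u where "\<forall>i. u i \<in> carrier B \<and> v i = g (u i)" by metis
      then have "range u \<subseteq> carrier B" "v = g \<circ> u" by auto
      with B eval[of u] show "eval A v p = eval A v q" by simp
    qed
  qed
  then have "A \<Turnstile> e \<longleftrightarrow> B \<Turnstile> e" for e by (cases e) simp
  moreover have "algebra A" using assms(2) \<open>inj g\<close> by (auto simp: algebra_def A_def)
  ultimately show ?thesis by blast
qed

text \<open>The list \<open>bs\<close> records membership in the eight varieties. Agreement on all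
  identities is kept as well, to test the defining identities of semilattices and De Morgan
  algebras.\<close>

lemma ex_table:
  assumes "infinite (UNIV :: 'a set)" and "table T \<in> I_variety"
    and "map (\<lambda>k. table T \<Turnstile> identity_A k) [1, 2, 3, 4, 6, 9, 11, 14] = bs"
  obtains A :: "'a zroupoid" where "A \<in> I_variety"
    and "map (\<lambda>k. A \<in> \<A> k) [1, 2, 3, 4, 6, 9, 11, 14] = bs" and "\<forall>e. A \<Turnstile> e \<longleftrightarrow> table T \<Turnstile> e"
proof -
  have "algebra (table T)" using assms(2) by (simp add: I_variety_def subvariety_def)
  with ex_copy[OF assms(1)] obtain A :: "'a zroupoid"
    where "algebra A" and A: "\<And>e. A \<Turnstile> e \<longleftrightarrow> table T \<Turnstile> e" by blast
  moreover from this have "A \<in> I_variety"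
    using assms(2) by (simp add: I_variety_def subvariety_def del: satisfies.simps)
  ultimately show ?thesis using assms(3) by (intro that[of A]) (simp_all add: mem_\<A>)
qed

lemma table_simps [simp]:
  "carrier (table T) = set [0..<length T]" "imp (table T) x y = T ! x ! y" "zero (table T) = 0"
  by (simp_all add: table_def)

text \<open>Quantifiers bounded by \<open>set [0..<length T]\<close> let \<open>code_simp\<close>
  decide membership by evaluation.\<close>

lemma table_mem_I_variety_iff:
  "table T \<in> I_variety \<longleftrightarrow> 0 \<in> set [0..<length T] \<and>
    (\<forall>x\<in>set [0..<length T]. \<forall>y\<in>set [0..<length T]. T ! x ! y \<in> set [0..<length T]) \<and>
    (\<forall>x\<in>set [0..<length T]. \<forall>y\<in>set [0..<length T]. \<forall>z\<in>set [0..<length T].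
       T ! (T ! x ! y) ! z = T ! (T ! (T ! (T ! z ! 0) ! x) ! (T ! (T ! y ! z) ! 0)) ! 0) \<and>
    T ! (T ! 0 ! 0) ! 0 = 0"
  unfolding I_variety_iff I_zroupoid_def table_simps by blast

lemma table_laws:
  "map (\<lambda>k. table T \<Turnstile> identity_A k) [1, 2, 3, 4, 6, 9, 11, 14] =
   map (\<lambda>P. \<forall>x\<in>set [0..<length T]. \<forall>y\<in>set [0..<length T]. \<forall>z\<in>set [0..<length T]. P x y z)
    [\<lambda>x y z. T ! x ! (T ! y ! z) = T ! (T ! x ! y) ! z,
     \<lambda>x y z. T ! x ! (T ! y ! z) = T ! x ! (T ! z ! y),
     \<lambda>x y z. T ! x ! (T ! y ! z) = T ! (T ! x ! z) ! y,
     \<lambda>x y z. T ! x ! (T ! y ! z) = T ! y ! (T ! x ! z),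
     \<lambda>x y z. T ! x ! (T ! y ! z) = T ! y ! (T ! z ! x),
     \<lambda>x y z. T ! x ! (T ! y ! z) = T ! z ! (T ! y ! x),
     \<lambda>x y z. T ! (T ! x ! y) ! z = T ! (T ! x ! z) ! y,
     \<lambda>x y z. T ! (T ! x ! y) ! z = T ! (T ! z ! y) ! x]"
  by (simp add: satisfies_identity_A)

text \<open>Classical implication on the truth values 0 and 1.\<close>

definition table_Boolean :: "nat list list" where
  "table_Boolean = [[1, 1], [0, 1]]"

lemma table_Boolean:
  "table table_Boolean \<in> I_variety"
  "map (\<lambda>k. table table_Boolean \<Turnstile> identity_A k) [1, 2, 3, 4, 6, 9, 11, 14] =
    [False, False, False, True, False, False, False, False]"
  unfolding table_mem_I_variety_iff table_laws by code_simp+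

text \<open>The right-zero band on 1 and 2 with 0 adjoined as a unit.\<close>

definition table_right_zero :: "nat list list" where
  "table_right_zero = [[0, 1, 2], [1, 1, 2], [2, 1, 2]]"

lemma table_right_zero:
  "table table_right_zero \<in> I_variety"
  "map (\<lambda>k. table table_right_zero \<Turnstile> identity_A k) [1, 2, 3, 4, 6, 9, 11, 14] =
    [True, False, False, False, False, False, False, False]"
  unfolding table_mem_I_variety_iff table_laws by code_simp+

text \<open>Found by a computer search for finite models.\<close>

definition table_four :: "nat list list" where
  "table_four = [[0, 1, 2, 3], [2, 3, 2, 3], [1, 1, 3, 3], [3, 3, 3, 3]]"

lemma table_four:
  "table table_four \<in> I_variety"
  "map (\<lambda>k. table table_four \<Turnstile> identity_A k) [1, 2, 3, 4, 6, 9, 11, 14] =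
    [False, False, False, True, False, False, False, True]"
  unfolding table_mem_I_variety_iff table_laws by code_simp+

text \<open>All products are 0, so every identity of associative type holds; it witnesses that (A3)
  and (A4) define more than semilattices and Boolean algebras.\<close>

definition table_null :: "nat list list" where
  "table_null = [[0, 0], [0, 0]]"

lemma table_null:
  "table table_null \<in> I_variety"
  "map (\<lambda>k. table table_null \<Turnstile> identity_A k) [1, 2, 3, 4, 6, 9, 11, 14] =
    [True, True, True, True, True, True, True, True]"
  unfolding table_mem_I_variety_iff table_laws by code_simp+

text \<open>
  In the next four tables every \<open>x \<rightarrow> 0\<close> and every \<open>(x \<rightarrow> y) \<rightarrow> z\<close> is \<open>0\<close>, so the axioms and (A11)-(A14)
  hold trivially and the products \<open>x \<rightarrow> (y \<rightarrow> z)\<close> can be prescribed: the nonzero ones are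
  \<open>1(12) = 2\<close>, \<open>1(22) = 4\<close>, \<open>1(21) = 4\<close>, and \<open>1(23) = 2(31) = 3(12) = 7\<close>, respectively.
\<close>

definition table_nil4 :: "nat list list" where
  "table_nil4 = [[0, 0, 0], [0, 0, 2], [0, 0, 0]]"

lemma table_nil4:
  "table table_nil4 \<in> I_variety"
  "map (\<lambda>k. table table_nil4 \<Turnstile> identity_A k) [1, 2, 3, 4, 6, 9, 11, 14] =
    [False, False, False, True, False, False, True, True]"
  unfolding table_mem_I_variety_iff table_laws by code_simp+

definition table_nil2 :: "nat list list" where
  "table_nil2 = [[0, 0, 0, 0, 0], [0, 0, 0, 4, 0],
     [0, 0, 3, 0, 0], [0, 0, 0, 0, 0], [0, 0, 0, 0, 0]]"

lemma table_nil2: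
  "table table_nil2 \<in> I_variety"
  "map (\<lambda>k. table table_nil2 \<Turnstile> identity_A k) [1, 2, 3, 4, 6, 9, 11, 14] =
    [False, True, False, False, False, False, True, True]"
  unfolding table_mem_I_variety_iff table_laws by code_simp+

definition table_nil9 :: "nat list list" where
  "table_nil9 = [[0, 0, 0, 0, 0], [0, 0, 0, 4, 0],
     [0, 3, 0, 0, 0], [0, 0, 0, 0, 0], [0, 0, 0, 0, 0]]"

lemma table_nil9:
  "table table_nil9 \<in> I_variety"
  "map (\<lambda>k. table table_nil9 \<Turnstile> identity_A k) [1, 2, 3, 4, 6, 9, 11, 14] =
    [False, False, False, False, False, True, True, True]"
  unfolding table_mem_I_variety_iff table_laws by code_simp+

definition table_nil6 :: "nat list list" where
  "table_nil6 = [[0, 0, 0, 0, 0, 0, 0, 0], [0, 0, 6, 0, 7, 0, 0, 0], [0, 0, 0, 4, 0, 7, 0, 0], [0, 5, 0, 0, 0, 0, 7, 0],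
     [0, 0, 0, 0, 0, 0, 0, 0], [0, 0, 0, 0, 0, 0, 0, 0], [0, 0, 0, 0, 0, 0, 0, 0], [0, 0, 0, 0, 0, 0, 0, 0]]"

lemma table_nil6:
  "table table_nil6 \<in> I_variety"
  "map (\<lambda>k. table table_nil6 \<Turnstile> identity_A k) [1, 2, 3, 4, 6, 9, 11, 14] =
    [False, False, False, False, True, False, True, True]"
  unfolding table_mem_I_variety_iff table_laws by code_simp+

section \<open>Distinctness and strictness of the inclusions\<close>

theorem theorem4p2:
  assumes "infinite (UNIV :: 'a set)"
  shows
    "((\<forall>V :: 'a zroupoid set. assoc_type_subvariety V \<longrightarrow>
         V \<in> {\<A> 1, \<A> 2, \<A> 3, \<A> 4, \<A> 6, \<A> 9, \<A> 11, \<A> 14}) \<and>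
      distinct [\<A> 1 :: 'a zroupoid set, \<A> 2, \<A> 3, \<A> 4, \<A> 6, \<A> 9, \<A> 11, \<A> 14]) \<and>
     ((SL_variety :: 'a zroupoid set) \<subset> \<A> 3 \<and> (\<A> 3 :: 'a zroupoid set) \<subset> \<A> 4) \<and>
     ((BA_variety :: 'a zroupoid set) \<subset> \<A> 4 \<and> (\<A> 4 :: 'a zroupoid set) \<subset> I_variety) \<and>
     ((\<A> 3 :: 'a zroupoid set) \<subset> \<A> 1 \<and> (\<A> 1 :: 'a zroupoid set) \<subset> I_variety) \<and>
     ((\<A> 3 :: 'a zroupoid set) \<subset> \<A> 2 \<and> (\<A> 2 :: 'a zroupoid set) \<subset> \<A> 11 \<and>
      (\<A> 3 :: 'a zroupoid set) \<subset> \<A> 6 \<and> (\<A> 6 :: 'a zroupoid set) \<subset> \<A> 11 \<and>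
      (\<A> 3 :: 'a zroupoid set) \<subset> \<A> 9 \<and> (\<A> 9 :: 'a zroupoid set) \<subset> \<A> 11) \<and>
     ((\<A> 11 :: 'a zroupoid set) \<subset> \<A> 14 \<and> (\<A> 14 :: 'a zroupoid set) \<subset> I_variety)"
proof -
  note ex = ex_table[OF assms]
  obtain B :: "'a zroupoid" where B: "B \<in> I_variety"
      "map (\<lambda>k. B \<in> \<A> k) [1, 2, 3, 4, 6, 9, 11, 14] =
        [False, False, False, True, False, False, False, False]"
    by (rule ex[OF table_Boolean])
  obtain R :: "'a zroupoid" where R: "R \<in> I_variety"
      "map (\<lambda>k. R \<in> \<A> k) [1, 2, 3, 4, 6, 9, 11, 14] =
        [True, False, False, False, False, False, False, False]"
    by (rule ex[OF table_right_zero])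
  obtain F :: "'a zroupoid" where F: "F \<in> I_variety"
      "map (\<lambda>k. F \<in> \<A> k) [1, 2, 3, 4, 6, 9, 11, 14] =
        [False, False, False, True, False, False, False, True]"
    by (rule ex[OF table_four])
  obtain N4 :: "'a zroupoid" where N4: "N4 \<in> I_variety"
      "map (\<lambda>k. N4 \<in> \<A> k) [1, 2, 3, 4, 6, 9, 11, 14] =
        [False, False, False, True, False, False, True, True]"
    by (rule ex[OF table_nil4])
  obtain N2 :: "'a zroupoid" where N2: "N2 \<in> I_variety"
      "map (\<lambda>k. N2 \<in> \<A> k) [1, 2, 3, 4, 6, 9, 11, 14] =
        [False, True, False, False, False, False, True, True]"
    by (rule ex[OF table_nil2])
  obtain N9 :: "'a zroupoid" where N9: "N9 \<in> I_variety"
      "map (\<lambda>k. N9 \<in> \<A> k) [1, 2, 3, 4, 6, 9, 11, 14] =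
        [False, False, False, False, False, True, True, True]"
    by (rule ex[OF table_nil9])
  obtain N6 :: "'a zroupoid" where N6: "N6 \<in> I_variety"
      "map (\<lambda>k. N6 \<in> \<A> k) [1, 2, 3, 4, 6, 9, 11, 14] =
        [False, False, False, False, True, False, True, True]"
    by (rule ex[OF table_nil6])
  obtain N0 :: "'a zroupoid" where "N0 \<in> I_variety"
      and N0: "map (\<lambda>k. N0 \<in> \<A> k) [1, 2, 3, 4, 6, 9, 11, 14] =
        [True, True, True, True, True, True, True, True]"
      and N0_iff: "\<forall>e. N0 \<Turnstile> e \<longleftrightarrow> table table_null \<Turnstile> e"
    by (rule ex[OF table_null])
  \<comment> \<open>Stacked as rows, the membership lists of these seven models have pairwise
    different columns.\<close>
  have distinct: "distinct [\<A> 1 :: 'a zroupoid set, \<A> 2, \<A> 3, \<A> 4, \<A> 6, \<A> 9, \<A> 11, \<A> 14]"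
    using B R F N4 N2 N9 N6 by auto
  \<comment> \<open>\<open>B\<close> lies outside (A1) and (A14), and \<open>R\<close> outside
    (A4).\<close>
  have proper: "\<A> k \<noteq> (I_variety :: 'a zroupoid set)" if "k \<in> {1, 4, 14}" for k
    using B R that by auto
  \<comment> \<open>Both identities fail at the element 1, since all products are 0.\<close>
  have "\<not> table table_null \<Turnstile> (X\<acute> \<approx> X)" "\<not> table table_null \<Turnstile> ((X \<rightarrow> Y) \<rightarrow> X \<approx> X)"
    by (auto simp: satisfies_XYZ table_null_def simp del: satisfies.simps)
  then have "N0 \<notin> SL_variety" "N0 \<notin> BA_variety"
    unfolding SL_variety_def BA_variety_def DM_variety_def subvariety_def N0_iff[rule_format, symmetric] by blast+
  with N0 have "SL_variety \<noteq> (\<A> 3 :: 'a zroupoid set)" "BA_variety \<noteq> (\<A> 4 :: 'a zroupoid set)"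
    by auto
  moreover have "\<A> k \<subseteq> (I_variety :: 'a zroupoid set)" for k
    by (auto simp: mem_\<A>)
  ultimately show ?thesis
    unfolding psubset_eq
    using distinct assoc_type_subvarietyD[where 'a = 'a] proper[of 1] proper[of 4] proper[of 14]
      SL_subset[where 'a = 'a] BA_subset[where 'a = 'a] \<A>_3_subset[where 'a = 'a]
      subset_\<A>_11[where 'a = 'a] \<A>_11_subset[where 'a = 'a]
    by (simp add: eq_sym_conv)
qed

end
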